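(* Consider the generalized semi-infinite program (GSIP) of minimizing $f(x)$ over $\mathcal{F}=\{x\in X:\ g(x,u)\ge 0\ \ \forall u\in U(x)\}$, and let $\{\hat x_k\}_{k=0}^\infty$ be the sequence produced by the exchange algorithm with polynomial extensions described in the context. Suppose $x^*$ is an accumulation point of this sequence. Assume the following: (i) in the $k$th loop, the problems $(P_k)$ and $(Q_{k,j})$ have minimizers $\hat x_k$ and $\hat u_{k,j}$ respectively; (ii) $(x^*,u^* )$ is an accumulation point of $\{(\hat x_k,\hat u_k)\}_{k=0}^\infty$, and the value function $v(x)=\min_{j\in[s]}\min_{u\in U(x)}g_j(x,u)$ is continuous at $x^*$; (iii) the polynomial extensions $q_{k,j}(x)$ are equicontinuous at $x^*$, i.e. for every $\epsilon>0$ there exists $\delta>0$ such that $\|q_{k,j}(x)-q_{k,j}(x^* )\|<\epsilon$ for all $\|x-x^*\|<\delta$ and for all $k,j$. Then $v(x^* )=0$ and $x^*$ is a minimizer of the GSIP.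
   Context: **Problem.** $f$ is a real polynomial in $x\in\mathbb{R}^n$, and $g(x,u)=(g_1(x,u),\dots,g_s(x,u))$ is a vector of real polynomials in $(x,u)\in\mathbb{R}^n\times\mathbb{R}^p$. The sets are $$X=\{x\in\mathbb{R}^n:\ c_i(x)=0\ (i\in\mathcal{I}_1),\ c_j(x)\ge 0\ (j\in\mathcal{J}_1)\},$$ $$U(x)=\{u\in\mathbb{R}^p:\ h_i(x,u)=0\ (i\in\mathcal{I}_2),\ h_j(x,u)\ge 0\ (j\in\mathcal{J}_2)\},$$ with all $c_i,c_j,h_i,h_j$ polynomials and $\mathcal{I}_1,\mathcal{J}_1,\mathcal{I}_2,\mathcal{J}_2$ finite label sets. Vector inequalities are entrywise. If $U(x)=\emptyset$, the constraint "$g(x,u)\ge 0\ \forall u\in U(x)$" holds automatically. Write $[s]=\{1,\dots,s\}$; $\|\cdot\|$ is the Euclidean norm. **Algorithm.** Start with $k=0$ and $\mathcal{F}_0=X$ (or any set $\mathcal{F}_0\supseteq\mathcal{F}$). In loop $k$: 1. Solve the problem $(P_k)$: $\min f(x)$ subject to $x\in\mathcal{F}_k$. If it is infeasible, output that the GSIP is infeasible and has no minimizers. If it is feasible and has minimizers, compute a minimizer $\hat x_k$. 2. For each $j\in[s]$, solve $(Q_{k,j})$: $\min g_j(\hat x_k,u)$ subject to $u\in U(\hat x_k)$. If $U(\hat x_k)=\emptyset$, set $\hat g_k=+\infty$. If $U(\hat x_k)\ne\emptyset$, compute the optimal value $\hat g_{k,j}$ and a minimizer $\hat u_{k,j}$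 (if any) of $(Q_{k,j})$, and set $\hat g_k=\min_{j\in[s]}\hat g_{k,j}$. 3. If $\hat g_k\ge 0$, output that $\hat x_k$ is a minimizer of the GSIP and stop. If $\hat g_k<0$, let $\mathcal{N}_k=\{j\in[s]:\hat g_{k,j}<0\}$ and, for each $j\in\mathcal{N}_k$, construct a polynomial extension $q_{k,j}$ of $\hat u_{k,j}$ for $U(x)$, i.e. a polynomial vector function $q_{k,j}:\mathbb{R}^n\to\mathbb{R}^p$ with $q_{k,j}(\hat x_k)=\hat u_{k,j}$ and $q_{k,j}(x)\in U(x)$ for all $x\in X$. 4. Set $\mathcal{F}_{k+1}=\{x\in\mathcal{F}_k:\ g(x,q_{k,j}(x))\ge 0,\ j\in\mathcal{N}_k\}$, replace $k$ by $k+1$ and return to step 1. **Notation.** $\hat u_k$ denotes the point $\hat u_{k,j}$ such that $g_j(\hat x_k,\hat u_{k,j})=\hat g_k$.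
   Formalization: The starting set F_0 is additionally required to be contained in X (F ⊆ F_0 ⊆ X); for F_0 not inside X the accumulation point x* may lie outside X, so the claim fails. *)

theory Defs
  imports "HOL-Analysis.Analysis"
begin

text \<open>
  The index set [s] of the constraint vector g is a finite type, so g takes values in
  \<open>real ^ 's\<close>, where \<open>\<le>\<close> is entrywise. A polynomial in (x,u) is a polynomial function on
  the product space.
\<close>

definition basic_set :: "'i set \<Rightarrow> 'i set \<Rightarrow> ('i \<Rightarrow> 'a \<Rightarrow> real) \<Rightarrow> 'a set" where
  "basic_set I J c = {x. (\<forall>i\<in>I. c i x = 0) \<and> (\<forall>j\<in>J. c j x \<ge> 0)}"

definition gsip_feasible ::
    "'a set \<Rightarrow> ('a \<Rightarrow> 'b set) \<Rightarrow> ('a \<times> 'b \<Rightarrow> real ^ 's) \<Rightarrow> 'a set" where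
  "gsip_feasible X U g = {x \<in> X. \<forall>u\<in>U x. g (x, u) \<ge> 0}"

text \<open>
  Optimal values are extended reals: \<open>\<infinity>\<close> for an empty set U(x), and \<open>-\<infinity>\<close> for an unbounded
  problem.
\<close>

definition opt_value ::
    "('a \<Rightarrow> 'b set) \<Rightarrow> ('a \<times> 'b \<Rightarrow> real ^ 's) \<Rightarrow> 's \<Rightarrow> 'a \<Rightarrow> ereal" where
  "opt_value U g j x = (INF u\<in>U x. ereal (g (x, u) $ j))"

definition value_fun ::
    "('a \<Rightarrow> 'b set) \<Rightarrow> ('a \<times> 'b \<Rightarrow> real ^ 's::finite) \<Rightarrow> 'a \<Rightarrow> ereal" where
  "value_fun U g x = (MIN j. opt_value U g j x)"

definition violated ::
    "('a \<Rightarrow> 'b set) \<Rightarrow> ('a \<times> 'b \<Rightarrow> real ^ 's) \<Rightarrow> 'a \<Rightarrow> 's set" where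
  "violated U g x = {j. opt_value U g j x < 0}"

definition polynomial_extension ::
    "'a::euclidean_space set \<Rightarrow> ('a \<Rightarrow> 'b::euclidean_space set) \<Rightarrow> 'a \<Rightarrow> 'b \<Rightarrow> ('a \<Rightarrow> 'b) \<Rightarrow> bool"
  where
  "polynomial_extension X U xh uh q \<longleftrightarrow>
     polynomial_function q \<and> q xh = uh \<and> (\<forall>x\<in>X. q x \<in> U x)"

text \<open>
  A nonterminating run of the exchange algorithm: \<open>Fs k\<close> is the feasible set of the k-th
  relaxation, \<open>xh k\<close> and \<open>uh k j\<close> are the points computed in loop k, and \<open>q k j\<close> the extension
  of \<open>uh k j\<close>, which is meaningful only for violated j. The optimal value over all j in loop k is
  \<open>value_fun U g (xh k)\<close>; it is negative in every loop because the algorithm would stop otherwise.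
  That \<open>xh k\<close> and \<open>uh k j\<close> are minimizers of the respective subproblems is not part of this
  definition; it is a separate hypothesis of the convergence theorem.
\<close>

definition exchange_run ::
    "'a::euclidean_space set \<Rightarrow> ('a \<Rightarrow> 'b::euclidean_space set) \<Rightarrow> ('a \<times> 'b \<Rightarrow> real ^ 's::finite) \<Rightarrow>
     'a set \<Rightarrow> (nat \<Rightarrow> 'a set) \<Rightarrow> (nat \<Rightarrow> 'a) \<Rightarrow> (nat \<Rightarrow> 's \<Rightarrow> 'b) \<Rightarrow> (nat \<Rightarrow> 's \<Rightarrow> 'a \<Rightarrow> 'b) \<Rightarrow> bool"
  where
  "exchange_run X U g F0 Fs xh uh q \<longleftrightarrow>
     Fs 0 = F0 \<and>
     (\<forall>k. value_fun U g (xh k) < 0) \<and>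
     (\<forall>k. \<forall>j\<in>violated U g (xh k). polynomial_extension X U (xh k) (uh k j) (q k j)) \<and>
     (\<forall>k. Fs (Suc k) = {x \<in> Fs k. \<forall>j\<in>violated U g (xh k). g (x, q k j x) \<ge> 0})"

definition accumulation_point :: "(nat \<Rightarrow> 'a::topological_space) \<Rightarrow> 'a \<Rightarrow> bool" where
  "accumulation_point y l \<longleftrightarrow> (\<exists>r. strict_mono r \<and> (y \<circ> r) \<longlonglongrightarrow> l)"

end

(*
  The minimizers xh k of the nested relaxations satisfy f (xh k) <= inf f over the feasible set, so
  everything reduces to v(xs) = 0. The bound v(xs) <= 0 is the limit of v(xh k) < 0. For the other
  direction, all later iterates satisfy the cut g (x, q k j x) >= 0 made in loop k, hence so does
  their limit xs; since q k j (xh k) = um k, equicontinuity shows that q k j xs has the same limit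
  us as um k, and the cuts give g (xs, us) >= 0. As v(xh k) is a component of g (xh k, um k), its
  limit v(xs) cannot be negative.
*)
theory Submission imports Defs begin

lemma closed_basic_set:
  fixes c :: "'i \<Rightarrow> 'a::topological_space \<Rightarrow> real"
  assumes "\<And>i. i \<in> I \<union> J \<Longrightarrow> continuous_on UNIV (c i)"
  shows "closed (basic_set I J c)"
proof -
  have eq: "basic_set I J c = (\<Inter>i\<in>I. {x. c i x = 0}) \<inter> (\<Inter>j\<in>J. {x. 0 \<le> c j x})"
    by (auto simp: basic_set_def)
  show ?thesis
    unfolding eq
    by (intro closed_Int closed_INT ballI closed_Collect_eq closed_Collect_le continuous_on_const)
      (use assms in auto)
qed

lemma value_fun_le_opt_value: "value_fun U g x \<le> opt_value U g j x"
  by (simp add: value_fun_def)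

lemma opt_value_le: "u \<in> U x \<Longrightarrow> opt_value U g j x \<le> ereal (g (x, u) $ j)"
  unfolding opt_value_def by (rule INF_lower)

text \<open>\<open>value_fun U g x\<close> is a lower bound for every component of
  \<open>g (x, u)\<close> with \<open>u\<close> in \<open>U x\<close>; an empty \<open>U x\<close>
  imposes nothing.\<close>

lemma gsip_feasible_if_value_fun_nonneg:
  assumes "x \<in> X" "0 \<le> value_fun U g x"
  shows "x \<in> gsip_feasible X U g"
proof -
  have "0 \<le> g (x, u) $ j" if "u \<in> U x" for u j
  proof -
    have "0 \<le> ereal (g (x, u) $ j)"
      using assms(2) value_fun_le_opt_value[of U g x j]
        opt_value_le[where U = U and g = g and x = x and u = u and j = j, OF that]
      by (blast intro: order_trans)
    then show ?thesis by simp
  qed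
  then show ?thesis
    using assms(1) by (auto simp: gsip_feasible_def less_eq_vec_def)
qed

lemma exchange_run_Fs_antimono:
  assumes "exchange_run X U g F0 Fs xh uh q" "k \<le> l"
  shows "Fs l \<subseteq> Fs k"
  by (rule lift_Suc_antimono_le[OF _ assms(2)]) (use assms(1) in \<open>auto simp: exchange_run_def\<close>)

lemma exchange_run_Fs_subset_F0:
  assumes "exchange_run X U g F0 Fs xh uh q"
  shows "Fs k \<subseteq> F0"
  using exchange_run_Fs_antimono[OF assms, of 0 k] assms by (auto simp: exchange_run_def)

text \<open>No cut removes a feasible point: for \<open>x\<close> in \<open>X\<close> the extension
  value \<open>q k j x\<close> lies in \<open>U x\<close>, so the cut is one of the constraints that
  \<open>x\<close> already satisfies.\<close>

lemma exchange_run_feasible_subset: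
  assumes run: "exchange_run X U g F0 Fs xh uh q" and F0: "gsip_feasible X U g \<subseteq> F0"
  shows "gsip_feasible X U g \<subseteq> Fs k"
proof (induction k)
  case 0
  then show ?case using run F0 by (simp add: exchange_run_def)
next
  case (Suc k)
  then show ?case
    using run by (auto simp: exchange_run_def gsip_feasible_def polynomial_extension_def)
qed

text \<open>The inequality \<open>k < l\<close> is strict because the cuts built in loop
  \<open>k\<close> first take effect in \<open>Fs (Suc k)\<close>.\<close>

lemma exchange_run_cut:
  assumes run: "exchange_run X U g F0 Fs xh uh q"
    and j: "j \<in> violated U g (xh k)" and "k < l" "x \<in> Fs l"
  shows "0 \<le> g (x, q k j x)"
proof -
  have "x \<in> Fs (Suc k)"
    using exchange_run_Fs_antimono[OF run, of "Suc k" l] assms(3,4) by auto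
  then show ?thesis using run j by (auto simp: exchange_run_def)
qed

text \<open>One \<delta> serves all \<open>k\<close>, so the difference
  \<open>q k (x k) - q k a\<close> tends to 0 although the function changes along with its
  argument.\<close>

lemma equicontinuous_tendsto:
  fixes q :: "nat \<Rightarrow> 'a::real_normed_vector \<Rightarrow> 'b::real_normed_vector"
  assumes equi: "\<And>\<epsilon>. \<epsilon> > 0 \<Longrightarrow> \<exists>\<delta>>0. \<forall>x. norm (x - a) < \<delta> \<longrightarrow> (\<forall>k. norm (q k x - q k a) < \<epsilon>)"
    and x: "x \<longlonglongrightarrow> a" and qx: "(\<lambda>k. q k (x k)) \<longlonglongrightarrow> b"
  shows "(\<lambda>k. q k a) \<longlonglongrightarrow> b"
proof -
  have "(\<lambda>k. q k (x k) - q k a) \<longlonglongrightarrow> 0"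
  proof (rule tendstoI)
    fix e :: real
    assume "0 < e"
    then obtain d where d: "d > 0" "\<And>y k. norm (y - a) < d \<Longrightarrow> norm (q k y - q k a) < e"
      using equi by metis
    have "\<forall>\<^sub>F k in sequentially. norm (x k - a) < d"
      using tendstoD[OF x d(1)] by (simp add: dist_norm)
    then show "\<forall>\<^sub>F k in sequentially. dist (q k (x k) - q k a) 0 < e"
      by eventually_elim (use d(2) in simp)
  qed
  from tendsto_diff[OF qx this] show ?thesis by simp
qed

lemma tendsto_vec_nonneg:
  fixes y :: "nat \<Rightarrow> real ^ 's"
  assumes "y \<longlonglongrightarrow> l" "\<forall>\<^sub>F n in sequentially. 0 \<le> y n"
  shows "0 \<le> l"
  unfolding less_eq_vec_def
proof
  fix j
  have "0 \<le> l $ j"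
    by (rule tendsto_lowerbound[OF tendsto_vec_nth[OF assms(1), of j]])
      (use assms(2) in \<open>auto elim!: eventually_mono simp: less_eq_vec_def\<close>)
  then show "0 $ j \<le> l $ j" by simp
qed

text \<open>The index \<open>j n\<close> may vary with \<open>n\<close>, so no single component of
  \<open>l\<close> need be the limit. The norm controls all components at once, which gives the
  lower bound \<open>- e\<close> whatever \<open>j n\<close> is.\<close>

lemma ereal_component_tendsto_nonneg:
  fixes y :: "nat \<Rightarrow> real ^ 's"
  assumes "y \<longlonglongrightarrow> l" "0 \<le> l" "(\<lambda>n. ereal (y n $ j n)) \<longlonglongrightarrow> w"
  shows "0 \<le> w"
proof (rule ereal_le_epsilon2)
  fix e :: real
  assume e: "0 < e"
  have "\<forall>\<^sub>F n in sequentially. ereal (- e) \<le> ereal (y n $ j n)"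
    using tendstoD[OF assms(1) e]
  proof eventually_elim
    case (elim n)
    have "\<bar>(y n - l) $ j n\<bar> < e"
      using component_le_norm_cart[of "y n - l" "j n"] elim by (simp add: dist_norm)
    moreover have "0 \<le> l $ j n" using assms(2) by (simp add: less_eq_vec_def)
    ultimately show ?case by simp
  qed
  then have "ereal (- e) \<le> w"
    using assms(3) by (intro tendsto_lowerbound) auto
  \<comment> \<open>The bound \<open>- e\<close> rules out the limit \<open>-\<infinity>\<close>;
    the value \<open>\<infinity>\<close> is harmless.\<close>
  then show "0 \<le> w + ereal e" by (cases w) auto
qed

theorem theorem3p5:
  fixes f :: "real ^ 'n \<Rightarrow> real"
    and g :: "(real ^ 'n) \<times> (real ^ 'p) \<Rightarrow> real ^ 's"
    and I1 J1 :: "'i set" and c :: "'i \<Rightarrow> real ^ 'n \<Rightarrow> real"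
    and I2 J2 :: "'l set" and h :: "'l \<Rightarrow> (real ^ 'n) \<times> (real ^ 'p) \<Rightarrow> real"
    and X F0 :: "(real ^ 'n) set" and U :: "real ^ 'n \<Rightarrow> (real ^ 'p) set"
    and Fs :: "nat \<Rightarrow> (real ^ 'n) set"
    and xh :: "nat \<Rightarrow> real ^ 'n"
    and uh :: "nat \<Rightarrow> 's \<Rightarrow> real ^ 'p"
    and um :: "nat \<Rightarrow> real ^ 'p"
    and q :: "nat \<Rightarrow> 's \<Rightarrow> real ^ 'n \<Rightarrow> real ^ 'p"
    and xs :: "real ^ 'n" and us :: "real ^ 'p"
  assumes f_poly: "real_polynomial_function f"
    and g_poly: "polynomial_function g"
    and finite_labels: "finite I1" "finite J1" "finite I2" "finite J2"
    and c_poly: "\<And>i. i \<in> I1 \<union> J1 \<Longrightarrow> real_polynomial_function (c i)"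
    and h_poly: "\<And>i. i \<in> I2 \<union> J2 \<Longrightarrow> real_polynomial_function (h i)"
    and X_eq: "X = basic_set I1 J1 c"
    and U_eq: "\<And>x. U x = basic_set I2 J2 (\<lambda>i u. h i (x, u))"
    and F0: "gsip_feasible X U g \<subseteq> F0" "F0 \<subseteq> X"
    and run: "exchange_run X U g F0 Fs xh uh q"
    and um: "\<And>k. \<exists>j. um k = uh k j \<and> ereal (g (xh k, uh k j) $ j) = value_fun U g (xh k)"
    and acc_x: "accumulation_point xh xs"
    and P_min: "\<And>k. is_arg_min f (\<lambda>x. x \<in> Fs k) (xh k)"
    and Q_min: "\<And>k j. is_arg_min (\<lambda>u. g (xh k, u) $ j) (\<lambda>u. u \<in> U (xh k)) (uh k j)"
    and acc_xu: "accumulation_point (\<lambda>k. (xh k, um k)) (xs, us)"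
    and v_cont: "isCont (value_fun U g) xs"
    and equicont: "\<And>\<epsilon>. \<epsilon> > 0 \<Longrightarrow> \<exists>\<delta>>0. \<forall>x. norm (x - xs) < \<delta> \<longrightarrow>
        (\<forall>k. \<forall>j\<in>violated U g (xh k). norm (q k j x - q k j xs) < \<epsilon>)"
  shows "value_fun U g xs = 0 \<and> is_arg_min f (\<lambda>x. x \<in> gsip_feasible X U g) xs"
proof -
  define F where "F = gsip_feasible X U g"
  have cont_f: "continuous_on UNIV f"
    using f_poly by (simp add: continuous_on_polymonial_function real_polynomial_function_eq)
  have cont_g: "isCont g z" for z
    using g_poly by (rule continuous_polymonial_function)
  have "closed X"
    unfolding X_eq using c_poly
    by (intro closed_basic_set)
      (simp add: continuous_on_polymonial_function real_polynomial_function_eq)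
  have xh_Fs: "xh k \<in> Fs k" and f_xh: "x \<in> Fs k \<Longrightarrow> f (xh k) \<le> f x" for k x
    using P_min[of k] by (auto simp: is_arg_min_linorder)
  have xh_X: "xh k \<in> X" for k
    using xh_Fs exchange_run_Fs_subset_F0[OF run] F0(2) by blast
  obtain j where uj: "\<And>k. um k = uh k (j k)"
    and vj: "\<And>k. ereal (g (xh k, um k) $ j k) = value_fun U g (xh k)"
    using um by metis
  have v_neg: "value_fun U g (xh k) < 0" for k
    using run by (simp add: exchange_run_def)
  \<comment> \<open>Only violated indices come with cuts, interpolation and equicontinuity. The
    index \<open>j k\<close> is one, since \<open>um k\<close> is admissible and its component
    \<open>j k\<close> attains the negative value of loop \<open>k\<close>.\<close>
  have j_violated: "j k \<in> violated U g (xh k)" for k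
  proof -
    have "uh k (j k) \<in> U (xh k)"
      using Q_min[where j = "j k"] by (simp add: is_arg_min_def)
    then have "opt_value U g (j k) (xh k) \<le> value_fun U g (xh k)"
      using opt_value_le[where U = U and g = g and x = "xh k" and u = "um k" and j = "j k"] vj[of k]
      by (simp add: uj)
    then show ?thesis using v_neg by (auto simp: violated_def intro: le_less_trans)
  qed
  have q_xh: "q k (j k) (xh k) = um k" for k
    using run j_violated by (simp add: exchange_run_def polynomial_extension_def uj)
  obtain r where r: "strict_mono r" and lim: "(\<lambda>n. (xh (r n), um (r n))) \<longlonglongrightarrow> (xs, us)"
    using acc_xu by (auto simp: accumulation_point_def o_def)
  have lim_x: "(\<lambda>n. xh (r n)) \<longlonglongrightarrow> xs" and lim_u: "(\<lambda>n. um (r n)) \<longlonglongrightarrow> us"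
    using tendsto_fst[OF lim] tendsto_snd[OF lim] by simp_all
  \<comment> \<open>Along the subsequence, \<open>p n\<close> is the extension through the worst
    point: it sends \<open>xh (r n)\<close> to \<open>um (r n)\<close>.\<close>
  define p where "p n = q (r n) (j (r n))" for n
  \<comment> \<open>Here \<open>n\<close> stays fixed and the later iterates
    \<open>xh (r m)\<close>, which all obey the cut of loop \<open>r n\<close>, tend to
    \<open>xs\<close>.\<close>
  have cut: "0 \<le> g (xs, p n xs)" for n
  proof (rule tendsto_vec_nonneg)
    have "polynomial_function (p n)"
      using run j_violated by (simp add: exchange_run_def polynomial_extension_def p_def)
    then have "isCont (p n) xs" by (rule continuous_polymonial_function)
    then have "(\<lambda>m. p n (xh (r m))) \<longlonglongrightarrow> p n xs"
      using lim_x by (rule isCont_tendsto_compose)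
    then show "(\<lambda>m. g (xh (r m), p n (xh (r m)))) \<longlonglongrightarrow> g (xs, p n xs)"
      by (intro isCont_tendsto_compose[OF cont_g] tendsto_Pair lim_x)
    show "\<forall>\<^sub>F m in sequentially. 0 \<le> g (xh (r m), p n (xh (r m)))"
      using eventually_gt_at_top[of n]
    proof eventually_elim
      case (elim m)
      then have "r n < r m" using r by (simp add: strict_monoD)
      then show ?case
        unfolding p_def by (rule exchange_run_cut[OF run j_violated]) (rule xh_Fs)
    qed
  qed
  have "(\<lambda>n. p n xs) \<longlonglongrightarrow> us"
  proof (rule equicontinuous_tendsto[OF _ lim_x])
    show "(\<lambda>n. p n (xh (r n))) \<longlonglongrightarrow> us" using lim_u by (simp add: p_def q_xh)
    show "\<exists>\<delta>>0. \<forall>x. norm (x - xs) < \<delta> \<longrightarrow> (\<forall>n. norm (p n x - p n xs) < \<epsilon>)" if "\<epsilon> > 0" for \<epsilon>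
      using equicont[OF that] j_violated unfolding p_def by blast
  qed
  then have "(\<lambda>n. g (xs, p n xs)) \<longlonglongrightarrow> g (xs, us)"
    by (intro isCont_tendsto_compose[OF cont_g] tendsto_Pair tendsto_const)
  then have g_nonneg: "0 \<le> g (xs, us)"
    using cut by (intro tendsto_vec_nonneg) auto
  have lim_v: "(\<lambda>n. value_fun U g (xh (r n))) \<longlonglongrightarrow> value_fun U g xs"
    using v_cont lim_x by (rule isCont_tendsto_compose)
  have v_nonneg: "0 \<le> value_fun U g xs"
  \<comment> \<open>The minimizing index \<open>j (r n)\<close> need not settle down, hence the
    version with a moving component.\<close>
  proof (rule ereal_component_tendsto_nonneg[OF _ g_nonneg])
    show "(\<lambda>n. g (xh (r n), um (r n))) \<longlonglongrightarrow> g (xs, us)"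
      using lim by (rule isCont_tendsto_compose[OF cont_g])
    show "(\<lambda>n. ereal (g (xh (r n), um (r n)) $ j (r n))) \<longlonglongrightarrow> value_fun U g xs"
      using lim_v by (simp add: vj)
  qed
  have "value_fun U g xs \<le> 0"
    by (rule tendsto_upperbound[OF lim_v]) (simp_all add: less_imp_le[OF v_neg])
  moreover have "xs \<in> X"
    by (rule closed_sequentially[OF \<open>closed X\<close> _ lim_x]) (rule xh_X)
  then have "xs \<in> F"
    unfolding F_def using v_nonneg by (rule gsip_feasible_if_value_fun_nonneg)
  \<comment> \<open>Each \<open>Fs k\<close> contains \<open>F\<close>, so
    \<open>f (xh k) \<le> f x\<close> in every loop, and the inequality passes to the limit.\<close>
  moreover have "f xs \<le> f x" if "x \<in> F" for x
  proof (rule tendsto_upperbound)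
    show "(\<lambda>n. f (xh (r n))) \<longlonglongrightarrow> f xs"
      using cont_f lim_x by (auto intro: continuous_on_tendsto_compose)
    show "\<forall>\<^sub>F n in sequentially. f (xh (r n)) \<le> f x"
      using exchange_run_feasible_subset[OF run F0(1)] that
      by (intro always_eventually allI f_xh) (auto simp: F_def)
  qed simp
  ultimately show ?thesis
    using v_nonneg by (simp add: is_arg_min_linorder F_def)
qed

end
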